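(* Let $\xi$ be an ordering of the Pascal graph, with path space $X$, and let $k\ge 1$. Suppose $\gamma,\gamma'\in X$ are distinct paths that are determined by sequences $\omega,\omega'\in\mathscr P_k^{\mathbb Z}$, respectively, with $\xi$-consistent factoring schemes, and consider the full $\mathbb Z$-orbits $(T_\xi^m\gamma)_{m\in\mathbb Z}$ and $(T_\xi^m\gamma')_{m\in\mathbb Z}$ under $T_\xi$ (extended if necessary) given by these sequences and schemes. Then the $3$-codings of $\gamma$ and $\gamma'$ are not the same: there is $m\in\mathbb Z$ such that $T_\xi^m\gamma$ and $T_\xi^m\gamma'$ do not have the same first three edges.
   Context: The Pascal graph has vertex set $\mathscr V=\{(x,y):x,y\in\mathbb Z_{\ge0}\}$ and, for each $(x,y)\in\mathscr V$, one directed edge from $(x,y)$ to $(x+1,y)$ and one to $(x,y+1)$. The level of $(x,y)$ is $x+y$; the root is $(0,0)$. An ordering is a function $\xi:\mathscr V\to\{0,1\}$: for $x,y\ge1$ the edge from $(x-1,y)$ to $(x,y)$ is less than the edge from $(x,y-1)$ to $(x,y)$ if and only if $\xi(x,y)=1$ (the values of $\xi$ at vertices with $x=0$ or $y=0$ play no role; the unique edge entering such a non-root vertex is both minimal and maximal). $X$ is the set of infinite directed paths (edge sequences $\gamma=\gamma_1\gamma_2\dots$) starting at the root. Paths $\gamma\ne\eta$ are comparable if they eventually coincide; if $n$ is the largest index with $\gamma_n\neq\eta_n$, then $\gamma<\eta$ iff $\gamma_n<\eta_n$. Finite paths from the root to a common vertex are ordered the same way. $X_{\xi,\max}$ (resp.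 $X_{\xi,\min}$) is the set of paths all of whose edges are maximal (resp. minimal). For $\gamma\notin X_{\xi,\max}$, $T_\xi\gamma$ is the smallest path larger than $\gamma$; $T_\xi^{-1}$ is defined off $X_{\xi,\min}$. For $k\ge1$, $\mathscr P_k$ is the set of the $2^k$ paths of length $k$ from the root, used as symbols (identified with the corresponding cylinder sets). Basic blocks $B^k_\xi(x,y)$, $x+y\ge k$, are words over $\mathscr P_k$: if $x+y=k$, $B^k_\xi(x,y)$ is the list in increasing order of all paths from the root to $(x,y)$; if $x+y>k$ and $x,y\ge1$, $B^k_\xi(x,y)=B^k_\xi(x,y-1)B^k_\xi(x-1,y)$ if $\xi(x,y)=0$ and $B^k_\xi(x,y)=B^k_\xi(x-1,y)B^k_\xi(x,y-1)$ if $\xi(x,y)=1$; and for $n>k$, $B^k_\xi(n,0)=B^k_\xi(k,0)$ and $B^k_\xi(0,n)=B^k_\xi(0,k)$. A $\xi$-consistent factoring scheme for $\omega\in\mathscr P_k^{\mathbb Z}$ consists, for each $n\ge k$, of a way of writing $\omega$ as a bi-infinite concatenation $\dots W_{n,-1}W_{n,0}W_{n,1}\dots$ of finite blocks, and vertices $(x_{n,i},y_{n,i})$ of level $n$, such that: (1) $W_{n,i}=B^k_\xi(x_{n,i},y_{n,i})$ for all $i$; (2) for $n>k$, if $x_{n,i},y_{n,i}\ge1$, then $W_{n,i}$ occupies exactly the coordinates of two consecutive level-$(n-1)$ blocks $W_{n-1,j}W_{n-1,j+1}$, whose vertices are, in this order, $(x_{n,i},y_{n,i}-1),(x_{n,i}-1,y_{n,i})$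 if $\xi(x_{n,i},y_{n,i})=0$, and $(x_{n,i}-1,y_{n,i}),(x_{n,i},y_{n,i}-1)$ if $\xi(x_{n,i},y_{n,i})=1$; if $y_{n,i}=0$ (resp. $x_{n,i}=0$), then $W_{n,i}$ occupies exactly the coordinate of one level-$(n-1)$ block, whose vertex is $(n-1,0)$ (resp. $(0,n-1)$); (3) for each coordinate $p\in\mathbb Z$, for all sufficiently large $n$ the level-$n$ block covering $p$ has a vertex with both coordinates at least $1$. Schemes differing only by reindexing are identified. Given $\omega$ with such a scheme and $m\in\mathbb Z$, let $\gamma^{(m)}\in X$ be the path such that for every $n\ge k$, if coordinate $m$ has offset $r_n\in\{0,1,\dots\}$ in the level-$n$ block covering it and this block has vertex $v_n$, then the initial segment of length $n$ of $\gamma^{(m)}$ is the $(r_n+1)$-st smallest path from the root to $v_n$. The path determined by $\omega$ (with the scheme) is $\gamma=\gamma^{(0)}$, and its full $\mathbb Z$-orbit is $T_\xi^m\gamma:=\gamma^{(m)}$, $m\in\mathbb Z$; this agrees with $T_\xi$ wherever the coordinates $m,m+1$ lie in a common block of some level, and otherwise extends $T_\xi$ by sending the maximal path $\gamma^{(m)}$ to the minimal path $\gamma^{(m+1)}$. The $3$-coding of $\gamma$ is the sequence whose $m$-th entry is the initial segment of length $3$ of $T_\xi^m\gamma$. *)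

theory Defs
  imports Main
begin

section \<open>The Pascal graph and its paths\<close>

type_synonym vertex = "nat \<times> nat"
type_synonym edge = "vertex \<times> vertex"

text \<open>There is at most one edge between two vertices, so an edge is the pair (source, target).\<close>

definition is_edge :: "edge \<Rightarrow> bool" where
  "is_edge e \<longleftrightarrow> (\<exists>x y. e = ((x, y), (x + 1, y)) \<or> e = ((x, y), (x, y + 1)))"

fun walk :: "vertex \<Rightarrow> edge list \<Rightarrow> vertex \<Rightarrow> bool" where
  "walk u [] v \<longleftrightarrow> u = v"
| "walk u (e # es) v \<longleftrightarrow> is_edge e \<and> fst e = u \<and> walk (snd e) es v"

definition paths_to :: "vertex \<Rightarrow> edge list set" where
  "paths_to v = {es. walk (0, 0) es v}"

definition paths_of_length :: "nat \<Rightarrow> edge list set" where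
  "paths_of_length k = {es. length es = k \<and> (\<exists>v. walk (0, 0) es v)}"

text \<open>Infinite paths are indexed from 0: \<open>\<gamma> n\<close> is the edge from level \<open>n\<close> to level \<open>n + 1\<close>.\<close>

definition path_space :: "(nat \<Rightarrow> edge) set" where
  "path_space = {\<gamma>. fst (\<gamma> 0) = (0, 0) \<and> (\<forall>n. is_edge (\<gamma> n) \<and> fst (\<gamma> (Suc n)) = snd (\<gamma> n))}"

definition initial_segment :: "nat \<Rightarrow> (nat \<Rightarrow> edge) \<Rightarrow> edge list" where
  "initial_segment n \<gamma> = map \<gamma> [0..<n]"


section \<open>Orderings\<close>

text \<open>The value 1 of an ordering is rendered as \<open>True\<close>, the value 0 as \<open>False\<close>.\<close>

type_synonym ordering = "vertex \<Rightarrow> bool"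

definition edge_less :: "ordering \<Rightarrow> edge \<Rightarrow> edge \<Rightarrow> bool" where
  "edge_less \<xi> e f \<longleftrightarrow> (\<exists>x y. x \<ge> 1 \<and> y \<ge> 1 \<and>
     (if \<xi> (x, y) then e = ((x - 1, y), (x, y)) \<and> f = ((x, y - 1), (x, y))
      else e = ((x, y - 1), (x, y)) \<and> f = ((x - 1, y), (x, y))))"

text \<open>Comparison at the last index where two paths differ. It is used for paths from the root to
  a common vertex.\<close>

definition path_less :: "ordering \<Rightarrow> edge list \<Rightarrow> edge list \<Rightarrow> bool" where
  "path_less \<xi> es fs \<longleftrightarrow> length es = length fs \<and>
     (\<exists>n < length es. edge_less \<xi> (es ! n) (fs ! n) \<and> (\<forall>i. n < i \<and> i < length es \<longrightarrow> es ! i = fs ! i))"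

definition infinite_path_less :: "ordering \<Rightarrow> (nat \<Rightarrow> edge) \<Rightarrow> (nat \<Rightarrow> edge) \<Rightarrow> bool" where
  "infinite_path_less \<xi> \<gamma> \<eta> \<longleftrightarrow> (\<exists>n. edge_less \<xi> (\<gamma> n) (\<eta> n) \<and> (\<forall>i>n. \<gamma> i = \<eta> i))"

text \<open>The adic transformation: the smallest path larger than \<open>\<gamma>\<close>
  (a dummy if \<open>\<gamma>\<close> is maximal).\<close>

definition adic :: "ordering \<Rightarrow> (nat \<Rightarrow> edge) \<Rightarrow> nat \<Rightarrow> edge" where
  "adic \<xi> \<gamma> = (THE \<eta>. \<eta> \<in> path_space \<and> infinite_path_less \<xi> \<gamma> \<eta> \<and>
     (\<forall>\<zeta>\<in>path_space. infinite_path_less \<xi> \<gamma> \<zeta> \<longrightarrow> \<zeta> = \<eta> \<or> infinite_path_less \<xi> \<eta> \<zeta>))"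

definition sorted_paths :: "ordering \<Rightarrow> vertex \<Rightarrow> edge list list" where
  "sorted_paths \<xi> v = (THE ps. set ps = paths_to v \<and> sorted_wrt (path_less \<xi>) ps)"


section \<open>Basic blocks\<close>

text \<open>Only vertices of level at least \<open>k\<close> (where \<open>k \<ge> 1\<close>) are of interest;
  below level \<open>k\<close> the value is a dummy.\<close>

function basic_block :: "ordering \<Rightarrow> nat \<Rightarrow> vertex \<Rightarrow> edge list list" where
  "basic_block \<xi> k (x, y) =
     (if x + y < k then []
      else if x + y = k then sorted_paths \<xi> (x, y)
      else if y = 0 then basic_block \<xi> k (k, 0)
      else if x = 0 then basic_block \<xi> k (0, k)
      else if \<xi> (x, y) then basic_block \<xi> k (x - 1, y) @ basic_block \<xi> k (x, y - 1)
      else basic_block \<xi> k (x, y - 1) @ basic_block \<xi> k (x - 1, y))"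
  by pat_completeness auto
termination
  by (relation "measure (\<lambda>(\<xi>, k, x, y). x + y)") auto

declare basic_block.simps [simp del]


section \<open>Consistent factoring schemes\<close>

text \<open>The \<open>i\<close>-th block of level \<open>n\<close> occupies the coordinates \<open>p\<close> with
  \<open>cut_point S n i \<le> p < cut_point S n (i + 1)\<close> and has the vertex \<open>vert S n i\<close>. Cut points given by a strictly
  increasing function from the integers to the integers are the same as a bi-infinite
  concatenation of nonempty finite blocks: such a function is unbounded in both directions.
  Basic blocks are nonempty, so nothing is lost by this. The fields are meaningful at
  levels \<open>n \<ge> k\<close> only.\<close>

record scheme =
  cut_point :: "nat \<Rightarrow> int \<Rightarrow> int"
  vert :: "nat \<Rightarrow> int \<Rightarrow> vertex"

definition covers :: "scheme \<Rightarrow> nat \<Rightarrow> int \<Rightarrow> int \<Rightarrow> bool" where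
  "covers S n i p \<longleftrightarrow> cut_point S n i \<le> p \<and> p < cut_point S n (i + 1)"

definition factor :: "(int \<Rightarrow> 'a) \<Rightarrow> scheme \<Rightarrow> nat \<Rightarrow> int \<Rightarrow> 'a list" where
  "factor \<omega> S n i = map \<omega> [cut_point S n i .. cut_point S n (i + 1) - 1]"

definition consistent_scheme ::
    "ordering \<Rightarrow> nat \<Rightarrow> (int \<Rightarrow> edge list) \<Rightarrow> scheme \<Rightarrow> bool" where
  "consistent_scheme \<xi> k \<omega> S \<longleftrightarrow>
     (\<forall>n\<ge>k. strict_mono (cut_point S n)) \<and>
     (\<forall>n\<ge>k. \<forall>i. fst (vert S n i) + snd (vert S n i) = n) \<and>
     (\<forall>n\<ge>k. \<forall>i. factor \<omega> S n i = basic_block \<xi> k (vert S n i)) \<and>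
     (\<forall>n>k. \<forall>i x y. vert S n i = (x, y) \<longrightarrow>
        (x \<ge> 1 \<and> y \<ge> 1 \<longrightarrow>
           (\<exists>j. cut_point S (n - 1) j = cut_point S n i \<and> cut_point S (n - 1) (j + 2) = cut_point S n (i + 1) \<and>
                (if \<xi> (x, y)
                 then vert S (n - 1) j = (x - 1, y) \<and> vert S (n - 1) (j + 1) = (x, y - 1)
                 else vert S (n - 1) j = (x, y - 1) \<and> vert S (n - 1) (j + 1) = (x - 1, y)))) \<and>
        (y = 0 \<longrightarrow>
           (\<exists>j. cut_point S (n - 1) j = cut_point S n i \<and> cut_point S (n - 1) (j + 1) = cut_point S n (i + 1) \<and>
                vert S (n - 1) j = (n - 1, 0))) \<and>
        (x = 0 \<longrightarrow>
           (\<exists>j. cut_point S (n - 1) j = cut_point S n i \<and> cut_point S (n - 1) (j + 1) = cut_point S n (i + 1) \<and>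
                vert S (n - 1) j = (0, n - 1)))) \<and>
     (\<forall>p. \<exists>N\<ge>k. \<forall>n\<ge>N. \<forall>i. covers S n i p \<longrightarrow> fst (vert S n i) \<ge> 1 \<and> snd (vert S n i) \<ge> 1)"


section \<open>The orbit determined by a factoring scheme\<close>

text \<open>\<open>orbit \<xi> k S m\<close> is the path at coordinate \<open>m\<close>. It is the \<open>m\<close>-th point of the full orbit,
  under the (extended) adic transformation, of the path \<open>orbit \<xi> k S 0\<close> determined by the
  sequence with scheme \<open>S\<close>. The \<open>(r + 1)\<close>-st smallest path to \<open>v\<close> is \<open>sorted_paths \<xi> v ! r\<close>,
  where \<open>r\<close> is the offset of \<open>m\<close> in the block covering it. Reindexing the blocks of \<open>S\<close> does
  not change the orbit. For consistent schemes the described path exists and is unique;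
  this is lemma \<open>is_orbit_path_orbit\<close> below. By lemma \<open>adic_orbit\<close>, passing from \<open>m\<close> to \<open>m + 1\<close>
  inside a block of any level is the adic transformation.\<close>

definition is_orbit_path ::
    "ordering \<Rightarrow> nat \<Rightarrow> scheme \<Rightarrow> int \<Rightarrow> (nat \<Rightarrow> edge) \<Rightarrow> bool" where
  "is_orbit_path \<xi> k S m \<gamma> \<longleftrightarrow> \<gamma> \<in> path_space \<and>
     (\<forall>n\<ge>k. \<exists>i. covers S n i m \<and>
        initial_segment n \<gamma> = sorted_paths \<xi> (vert S n i) ! nat (m - cut_point S n i))"

definition orbit :: "ordering \<Rightarrow> nat \<Rightarrow> scheme \<Rightarrow> int \<Rightarrow> nat \<Rightarrow> edge" where
  "orbit \<xi> k S m = (THE \<gamma>. is_orbit_path \<xi> k S m \<gamma>)"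

definition three_coding :: "ordering \<Rightarrow> nat \<Rightarrow> scheme \<Rightarrow> int \<Rightarrow> edge list" where
  "three_coding \<xi> k S m = initial_segment 3 (orbit \<xi> k S m)"


section \<open>Well-definedness of the descriptions\<close>

subsection \<open>Sorted lists of paths\<close>

lemma edge_less_asym: "edge_less \<xi> e f \<Longrightarrow> \<not> edge_less \<xi> f e"
  unfolding edge_less_def by (auto split: if_splits)

lemma path_less_asym:
  assumes "path_less \<xi> es fs" shows "\<not> path_less \<xi> fs es"
proof
  assume "path_less \<xi> fs es"
  then obtain n' where n': "n' < length fs" "edge_less \<xi> (fs ! n') (es ! n')"
      "\<And>i. n' < i \<Longrightarrow> i < length fs \<Longrightarrow> fs ! i = es ! i"
    unfolding path_less_def by blast
  obtain n where n: "n < length es" "edge_less \<xi> (es ! n) (fs ! n)"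
      "\<And>i. n < i \<Longrightarrow> i < length es \<Longrightarrow> es ! i = fs ! i" "length es = length fs"
    using assms unfolding path_less_def by blast
  show False
    using n n' edge_less_asym by (metis linorder_neqE_nat)
qed

lemma sorted_wrt_unique:
  assumes "\<And>a b. P a b \<Longrightarrow> \<not> P b a"
    and "sorted_wrt P xs" "sorted_wrt P ys" "set xs = set ys"
  shows "xs = ys"
  using assms(2-)
proof (induction xs arbitrary: ys)
  case Nil
  then show ?case by simp
next
  case (Cons a xs)
  obtain b ys' where ys: "ys = b # ys'"
    using Cons.prems(3) by (cases ys) auto
  have "a = b"
    using Cons.prems assms(1) unfolding ys by (metis list.set_intros(1) set_ConsD sorted_wrt.simps(2))
  moreover have "a \<notin> set xs" "b \<notin> set ys'"
    using Cons.prems assms(1)[of a a] assms(1)[of b b] unfolding ys by auto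
  ultimately have "set xs = set ys'"
    using Cons.prems(3) unfolding ys by auto
  then show ?case
    using Cons.IH[of ys'] Cons.prems \<open>a = b\<close> unfolding ys by auto
qed

lemma sorted_pathsI:
  assumes "set ps = paths_to v" "sorted_wrt (path_less \<xi>) ps"
  shows "sorted_paths \<xi> v = ps"
  unfolding sorted_paths_def
  by (rule the_equality) (use assms sorted_wrt_unique[of "path_less \<xi>", OF path_less_asym] in auto)

lemma walk_append: "walk u (es @ fs) v \<longleftrightarrow> (\<exists>w. walk u es w \<and> walk w fs v)"
  by (induction es arbitrary: u) auto

lemma walk_level: "walk u es v \<Longrightarrow> fst v + snd v = fst u + snd u + length es"
  by (induction es arbitrary: u) (fastforce simp: is_edge_def)+

lemma length_paths_to: "es \<in> paths_to v \<Longrightarrow> length es = fst v + snd v"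
  using walk_level[of "(0, 0)" es v] by (simp add: paths_to_def)

lemma snoc_in_paths_to:
  "es @ [e] \<in> paths_to v \<longleftrightarrow> is_edge e \<and> snd e = v \<and> es \<in> paths_to (fst e)"
  by (cases "fst e") (auto simp: paths_to_def walk_append)

lemma paths_to_root: "paths_to (0, 0) = {[]}"
proof -
  have "es = []" if "es \<in> paths_to (0, 0)" for es
    using length_paths_to[OF that] by simp
  moreover have "[] \<in> paths_to (0, 0)"
    by (simp add: paths_to_def)
  ultimately show ?thesis by blast
qed

lemma paths_to_step:
  assumes "v \<noteq> (0, 0)"
  shows "paths_to v = (\<Union>u\<in>{u. is_edge (u, v)}. (\<lambda>es. es @ [(u, v)]) ` paths_to u)"
proof (intro equalityI subsetI)
  fix p assume p: "p \<in> paths_to v"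
  have "p \<noteq> []"
    using length_paths_to[OF p] assms by (cases v) auto
  then obtain es e where "p = es @ [e]"
    by (metis append_butlast_last_id)
  then show "p \<in> (\<Union>u\<in>{u. is_edge (u, v)}. (\<lambda>es. es @ [(u, v)]) ` paths_to u)"
    using p by (cases e) (auto simp: snoc_in_paths_to)
qed (auto simp: snoc_in_paths_to)

lemma path_less_snoc_same:
  assumes "path_less \<xi> es fs"
  shows "path_less \<xi> (es @ [e]) (fs @ [e])"
proof -
  obtain n where "length es = length fs" "n < length es" "edge_less \<xi> (es ! n) (fs ! n)"
      "\<forall>i. n < i \<and> i < length es \<longrightarrow> es ! i = fs ! i"
    using assms unfolding path_less_def by blast
  then show ?thesis
    unfolding path_less_def by (auto simp: nth_append intro!: exI[of _ n])
qed

lemma path_less_snoc_edge: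
  "length es = length fs \<Longrightarrow> edge_less \<xi> e f \<Longrightarrow> path_less \<xi> (es @ [e]) (fs @ [f])"
  unfolding path_less_def
  by (auto simp: nth_append intro!: exI[of _ "length fs"])

lemma sorted_paths_props:
  "set (sorted_paths \<xi> v) = paths_to v \<and> sorted_wrt (path_less \<xi>) (sorted_paths \<xi> v)"
  "v = (0, 0) \<Longrightarrow> sorted_paths \<xi> v = [[]]"
  "v = (Suc x, 0) \<Longrightarrow> sorted_paths \<xi> v = map (\<lambda>p. p @ [((x, 0), v)]) (sorted_paths \<xi> (x, 0))"
  "v = (0, Suc y) \<Longrightarrow> sorted_paths \<xi> v = map (\<lambda>p. p @ [((0, y), v)]) (sorted_paths \<xi> (0, y))"
  "v = (Suc x, Suc y) \<Longrightarrow> \<xi> v \<Longrightarrow> sorted_paths \<xi> v =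
     map (\<lambda>p. p @ [((x, Suc y), v)]) (sorted_paths \<xi> (x, Suc y)) @
     map (\<lambda>p. p @ [((Suc x, y), v)]) (sorted_paths \<xi> (Suc x, y))"
  "v = (Suc x, Suc y) \<Longrightarrow> \<not> \<xi> v \<Longrightarrow> sorted_paths \<xi> v =
     map (\<lambda>p. p @ [((Suc x, y), v)]) (sorted_paths \<xi> (Suc x, y)) @
     map (\<lambda>p. p @ [((x, Suc y), v)]) (sorted_paths \<xi> (x, Suc y))"
proof -
  define good where "good v \<longleftrightarrow> set (sorted_paths \<xi> v) = paths_to v \<and>
    sorted_wrt (path_less \<xi>) (sorted_paths \<xi> v)" for v
  have goodI: "good v \<and> sorted_paths \<xi> v = ps"
    if "set ps = paths_to v" "sorted_wrt (path_less \<xi>) ps" for v ps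
    using sorted_pathsI[OF that] that by (simp add: good_def)
  have edges: "{u. is_edge (u, (Suc x, 0))} = {(x, 0)}" "{u. is_edge (u, (0, Suc y))} = {(0, y)}"
    "{u. is_edge (u, (Suc x, Suc y))} = {(x, Suc y), (Suc x, y)}" for x y
    by (auto simp: is_edge_def)
  have mono: "sorted_wrt (path_less \<xi>) (map (\<lambda>p. p @ [e]) ps)"
    if "sorted_wrt (path_less \<xi>) ps" for e ps
    using sorted_wrt_mono_rel[OF path_less_snoc_same that] by (simp add: sorted_wrt_map)
  have less1: "edge_less \<xi> ((x, Suc y), (Suc x, Suc y)) ((Suc x, y), (Suc x, Suc y))"
    if "\<xi> (Suc x, Suc y)" for x y
    unfolding edge_less_def using that by (intro exI[of _ "Suc x"] exI[of _ "Suc y"]) simp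
  have less0: "edge_less \<xi> ((Suc x, y), (Suc x, Suc y)) ((x, Suc y), (Suc x, Suc y))"
    if "\<not> \<xi> (Suc x, Suc y)" for x y
    unfolding edge_less_def using that by (intro exI[of _ "Suc x"] exI[of _ "Suc y"]) simp
  have r: "good (0, 0) \<and> sorted_paths \<xi> (0, 0) = [[]]"
    by (rule goodI) (auto simp: paths_to_root)
  have a: "good (Suc x, 0) \<and> sorted_paths \<xi> (Suc x, 0) =
      map (\<lambda>p. p @ [((x, 0), (Suc x, 0))]) (sorted_paths \<xi> (x, 0))" if "good (x, 0)" for x
    by (rule goodI) (use that in \<open>auto simp: good_def mono paths_to_step[of "(Suc x, 0)"] edges\<close>)
  have b: "good (0, Suc y) \<and> sorted_paths \<xi> (0, Suc y) =
      map (\<lambda>p. p @ [((0, y), (0, Suc y))]) (sorted_paths \<xi> (0, y))" if "good (0, y)" for y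
    by (rule goodI) (use that in \<open>auto simp: good_def mono paths_to_step[of "(0, Suc y)"] edges\<close>)
  have c: "good (Suc x, Suc y) \<and> sorted_paths \<xi> (Suc x, Suc y) =
      map (\<lambda>p. p @ [((x, Suc y), (Suc x, Suc y))]) (sorted_paths \<xi> (x, Suc y)) @
      map (\<lambda>p. p @ [((Suc x, y), (Suc x, Suc y))]) (sorted_paths \<xi> (Suc x, y))"
    if "good (x, Suc y)" "good (Suc x, y)" "\<xi> (Suc x, Suc y)" for x y
    by (rule goodI)
      (use that in \<open>auto simp: good_def mono sorted_wrt_append paths_to_step[of "(Suc x, Suc y)"] edges
         length_paths_to less1 less0 intro!: path_less_snoc_edge\<close>)
  have d: "good (Suc x, Suc y) \<and> sorted_paths \<xi> (Suc x, Suc y) =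
      map (\<lambda>p. p @ [((Suc x, y), (Suc x, Suc y))]) (sorted_paths \<xi> (Suc x, y)) @
      map (\<lambda>p. p @ [((x, Suc y), (Suc x, Suc y))]) (sorted_paths \<xi> (x, Suc y))"
    if "good (x, Suc y)" "good (Suc x, y)" "\<not> \<xi> (Suc x, Suc y)" for x y
    by (rule goodI)
      (use that in \<open>auto simp: good_def mono sorted_wrt_append paths_to_step[of "(Suc x, Suc y)"] edges
         length_paths_to less1 less0 intro!: path_less_snoc_edge\<close>)
  have good: "good (x, y)" for x y
  proof (induction "x + y" arbitrary: x y rule: less_induct)
    case less
    show ?case
    proof (cases x)
      case 0
      then show ?thesis using less r b by (cases y) auto
    next
      case (Suc x')
      show ?thesis
      proof (cases y)
        case 0
        then show ?thesis using less a Suc by auto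
      next
        case y: (Suc y')
        then show ?thesis using less[of x' y] less[of x y'] c[of x' y'] d[of x' y'] Suc by auto
      qed
    qed
  qed
  show "set (sorted_paths \<xi> v) = paths_to v \<and> sorted_wrt (path_less \<xi>) (sorted_paths \<xi> v)"
    using good[of "fst v" "snd v"] by (simp add: good_def)
  show "v = (0, 0) \<Longrightarrow> sorted_paths \<xi> v = [[]]"
    using r by simp
  show "v = (Suc x, 0) \<Longrightarrow> sorted_paths \<xi> v = map (\<lambda>p. p @ [((x, 0), v)]) (sorted_paths \<xi> (x, 0))"
    using a[OF good] by simp
  show "v = (0, Suc y) \<Longrightarrow> sorted_paths \<xi> v = map (\<lambda>p. p @ [((0, y), v)]) (sorted_paths \<xi> (0, y))"
    using b[OF good] by simp
  show "v = (Suc x, Suc y) \<Longrightarrow> \<xi> v \<Longrightarrow> sorted_paths \<xi> v =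
     map (\<lambda>p. p @ [((x, Suc y), v)]) (sorted_paths \<xi> (x, Suc y)) @
     map (\<lambda>p. p @ [((Suc x, y), v)]) (sorted_paths \<xi> (Suc x, y))"
    using c[OF good good] by simp
  show "v = (Suc x, Suc y) \<Longrightarrow> \<not> \<xi> v \<Longrightarrow> sorted_paths \<xi> v =
     map (\<lambda>p. p @ [((Suc x, y), v)]) (sorted_paths \<xi> (Suc x, y)) @
     map (\<lambda>p. p @ [((x, Suc y), v)]) (sorted_paths \<xi> (x, Suc y))"
    using d[OF good good] by simp
qed

lemmas set_sorted_paths = sorted_paths_props(1)[THEN conjunct1]
  and sorted_paths_root = sorted_paths_props(2)[OF refl]
  and sorted_paths_bottom = sorted_paths_props(3)[OF refl]
  and sorted_paths_left = sorted_paths_props(4)[OF refl]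
  and sorted_paths_1 = sorted_paths_props(5)[OF refl]
  and sorted_paths_0 = sorted_paths_props(6)[OF refl]

lemma length_sorted_paths_boundary:
  "length (sorted_paths \<xi> (n, 0)) = 1" "length (sorted_paths \<xi> (0, n)) = 1"
  by (induction n) (simp_all add: sorted_paths_root sorted_paths_bottom sorted_paths_left)

lemma length_basic_block:
  "k \<le> x + y \<Longrightarrow> length (basic_block \<xi> k (x, y)) = length (sorted_paths \<xi> (x, y))"
proof (induction "x + y" arbitrary: x y rule: less_induct)
  case less
  have start: "basic_block \<xi> k (k, 0) = sorted_paths \<xi> (k, 0)" "basic_block \<xi> k (0, k) = sorted_paths \<xi> (0, k)"
    by (simp_all add: basic_block.simps)
  show ?case
  proof (cases "x + y = k \<or> x = 0 \<or> y = 0")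
    case True
    then show ?thesis
      using less.prems start length_sorted_paths_boundary[of \<xi>]
      by (subst basic_block.simps) auto
  next
    case False
    then obtain x' y' where "x = Suc x'" "y = Suc y'" "k < x + y"
      using less.prems by (metis le_neq_implies_less not0_implies_Suc)
    then show ?thesis
      using less.hyps[of x' y] less.hyps[of x y']
      by (cases "\<xi> (x, y)") (simp_all add: basic_block.simps[of \<xi> k "Suc x'" "Suc y'"] sorted_paths_1 sorted_paths_0)
  qed
qed


subsection \<open>Existence and uniqueness of orbit paths\<close>

lemma covers_unique:
  assumes "strict_mono (cut_point S n)" "covers S n i p" "covers S n j p"
  shows "i = j"
proof (rule ccontr)
  assume "i \<noteq> j"
  then have "i + 1 \<le> j \<or> j + 1 \<le> i" by linarith
  then show False
    using assms unfolding covers_def by (smt (verit) strict_mono_less_eq)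
qed

lemma covers_exists:
  assumes "strict_mono (cut_point S n)"
  shows "\<exists>i. covers S n i p"
proof -
  have step: "cut_point S n i + 1 \<le> cut_point S n (i + 1)" for i
    using strict_monoD[OF assms, of i "i + 1"] by simp
  have up: "cut_point S n 0 + int m \<le> cut_point S n (int m)" for m
  proof (induction m)
    case (Suc m)
    then show ?case using step[of "int m"] by (simp add: add.commute)
  qed simp
  have down: "cut_point S n (- int m) \<le> cut_point S n 0 - int m" for m
  proof (induction m)
    case (Suc m)
    then show ?case using step[of "- int (Suc m)"] by simp
  qed simp
  define lo where "lo = - int (nat (cut_point S n 0 - p))"
  have lo: "cut_point S n lo \<le> p"
    using down[of "nat (cut_point S n 0 - p)"] unfolding lo_def by linarith
  have ex: "\<exists>m. p < cut_point S n (lo + int m)"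
  proof -
    have "p < cut_point S n (int (nat (p - cut_point S n 0 + 1)))"
      using up[of "nat (p - cut_point S n 0 + 1)"] by linarith
    moreover have "lo + int (nat (int (nat (p - cut_point S n 0 + 1)) - lo)) = int (nat (p - cut_point S n 0 + 1))"
      unfolding lo_def by simp
    ultimately show ?thesis by metis
  qed
  define m where "m = (LEAST m. p < cut_point S n (lo + int m))"
  have m: "p < cut_point S n (lo + int m)"
    unfolding m_def using ex by (rule LeastI_ex)
  have "m \<noteq> 0" using lo m by (intro notI) simp
  then obtain m' where m': "m = Suc m'" using not0_implies_Suc by blast
  have "\<not> p < cut_point S n (lo + int m')"
    using not_less_Least[of m' "\<lambda>m. p < cut_point S n (lo + int m)"] m' unfolding m_def by simp
  then have "covers S n (lo + int m') p"
    using m unfolding covers_def m' by (simp add: algebra_simps)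
  then show ?thesis by blast
qed

context
  fixes \<xi> :: ordering and k :: nat and \<omega> :: "int \<Rightarrow> edge list" and S :: scheme
  assumes cs: "consistent_scheme \<xi> k \<omega> S"
begin

lemma scheme_mono: "k \<le> n \<Longrightarrow> strict_mono (cut_point S n)"
  and scheme_level: "k \<le> n \<Longrightarrow> fst (vert S n i) + snd (vert S n i) = n"
  and scheme_factor: "k \<le> n \<Longrightarrow> factor \<omega> S n i = basic_block \<xi> k (vert S n i)"
  using cs unfolding consistent_scheme_def by blast+

lemma scheme_length:
  assumes "k \<le> n"
  shows "cut_point S n (i + 1) - cut_point S n i = int (length (sorted_paths \<xi> (vert S n i)))"
proof -
  have "length (factor \<omega> S n i) = length (sorted_paths \<xi> (vert S n i))"
    using assms scheme_factor[OF assms, of i] scheme_level[OF assms, of i]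
      length_basic_block[of k "fst (vert S n i)" "snd (vert S n i)"] by simp
  moreover have "cut_point S n i < cut_point S n (i + 1)"
    using scheme_mono[OF assms] by (simp add: strict_mono_less)
  ultimately show ?thesis
    by (simp add: factor_def)
qed

lemma scheme_prefix:
  assumes n: "k < n" and i: "covers S n i m" and j: "covers S (n - 1) j m"
  shows "sorted_paths \<xi> (vert S n i) ! nat (m - cut_point S n i) =
    sorted_paths \<xi> (vert S (n - 1) j) ! nat (m - cut_point S (n - 1) j) @ [(vert S (n - 1) j, vert S n i)]"
proof -
  have n1: "k \<le> n - 1" using n by simp
  obtain x y where v: "vert S n i = (x, y)" by (cases "vert S n i")
  have xy: "x + y = n" using scheme_level[of n i] n v by simp
  have same: "j' = j" if "covers S (n - 1) j' m" for j'
    using covers_unique[OF scheme_mono[OF n1] that j] .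
  have offset: "nat (m - cut_point S (n - 1) j') < length (sorted_paths \<xi> (vert S (n - 1) j'))"
    if "covers S (n - 1) j' m" for j'
    using scheme_length[OF n1, of j'] that unfolding covers_def by linarith
  have rules: "(x \<ge> 1 \<and> y \<ge> 1 \<longrightarrow>
           (\<exists>j. cut_point S (n - 1) j = cut_point S n i \<and> cut_point S (n - 1) (j + 2) = cut_point S n (i + 1) \<and>
                (if \<xi> (x, y)
                 then vert S (n - 1) j = (x - 1, y) \<and> vert S (n - 1) (j + 1) = (x, y - 1)
                 else vert S (n - 1) j = (x, y - 1) \<and> vert S (n - 1) (j + 1) = (x - 1, y)))) \<and>
        (y = 0 \<longrightarrow>
           (\<exists>j. cut_point S (n - 1) j = cut_point S n i \<and> cut_point S (n - 1) (j + 1) = cut_point S n (i + 1) \<and>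
                vert S (n - 1) j = (n - 1, 0))) \<and>
        (x = 0 \<longrightarrow>
           (\<exists>j. cut_point S (n - 1) j = cut_point S n i \<and> cut_point S (n - 1) (j + 1) = cut_point S n (i + 1) \<and>
                vert S (n - 1) j = (0, n - 1)))"
    using cs n v unfolding consistent_scheme_def by blast
  consider (b) x' where "x = Suc x'" "y = 0" | (l) y' where "x = 0" "y = Suc y'"
    | (i) x' y' where "x = Suc x'" "y = Suc y'"
    using xy n by (metis add_is_0 not0_implies_Suc not_less0)
  then show ?thesis
  proof cases
    case b
    then obtain j' where j': "cut_point S (n - 1) j' = cut_point S n i" "cut_point S (n - 1) (j' + 1) = cut_point S n (i + 1)"
        "vert S (n - 1) j' = (x', 0)"
      using rules xy by auto
    then have "covers S (n - 1) j' m" using i by (simp add: covers_def)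
    then show ?thesis
      using same offset[of j'] j' v b by (auto simp: sorted_paths_bottom)
  next
    case l
    then obtain j' where j': "cut_point S (n - 1) j' = cut_point S n i" "cut_point S (n - 1) (j' + 1) = cut_point S n (i + 1)"
        "vert S (n - 1) j' = (0, y')"
      using rules xy by auto
    then have "covers S (n - 1) j' m" using i by (simp add: covers_def)
    then show ?thesis
      using same offset[of j'] j' v l by (auto simp: sorted_paths_left)
  next
    case inner: i
    define u1 where "u1 = (if \<xi> (x, y) then (x', y) else (x, y'))"
    define u2 where "u2 = (if \<xi> (x, y) then (x, y') else (x', y))"
    obtain j' where j': "cut_point S (n - 1) j' = cut_point S n i" "cut_point S (n - 1) (j' + 2) = cut_point S n (i + 1)"
        "vert S (n - 1) j' = u1" "vert S (n - 1) (j' + 1) = u2"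
      using rules inner by (auto simp: u1_def u2_def split: if_splits)
    have sp: "sorted_paths \<xi> (x, y) = map (\<lambda>p. p @ [(u1, (x, y))]) (sorted_paths \<xi> u1) @
        map (\<lambda>p. p @ [(u2, (x, y))]) (sorted_paths \<xi> u2)"
      using inner by (auto simp: u1_def u2_def sorted_paths_1 sorted_paths_0)
    have len: "cut_point S (n - 1) (j' + 1) = cut_point S n i + int (length (sorted_paths \<xi> u1))"
      using scheme_length[OF n1, of j'] j' by simp
    have "covers S (n - 1) j' m \<or> covers S (n - 1) (j' + 1) m"
      using i j' by (auto simp: covers_def add.commute)
    then show ?thesis
    proof
      assume c: "covers S (n - 1) j' m"
      then show ?thesis
        using same[OF c] offset[OF c] j' v sp by (auto simp: nth_append)
    next
      assume c: "covers S (n - 1) (j' + 1) m"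
      then have "cut_point S n i + int (length (sorted_paths \<xi> u1)) \<le> m"
        using len by (simp add: covers_def)
      then have "nat (m - cut_point S n i) = length (sorted_paths \<xi> u1) + nat (m - cut_point S (n - 1) (j' + 1))"
        unfolding len by linarith
      then show ?thesis
        using same[OF c] offset[OF c] j' v sp by (auto simp: nth_append)
    qed
  qed
qed

lemma is_orbit_path_ex1: "\<exists>!\<gamma>. is_orbit_path \<xi> k S m \<gamma>"
proof (rule ex_ex1I)
  define I where "I n = (SOME i. covers S n i m)" for n
  define u where "u n = vert S n (I n)" for n
  define P where "P n = sorted_paths \<xi> (u n) ! nat (m - cut_point S n (I n))" for n
  define \<gamma> where "\<gamma> j = P (max k (Suc j)) ! j" for j
  have I: "covers S n (I n) m" if "k \<le> n" for n
    unfolding I_def using covers_exists[OF scheme_mono[OF that]] by (rule someI_ex)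
  have P_in: "P n \<in> paths_to (u n)" if "k \<le> n" for n
  proof -
    have "nat (m - cut_point S n (I n)) < length (sorted_paths \<xi> (u n))"
      using scheme_length[OF that, of "I n"] I[OF that] unfolding covers_def u_def by linarith
    then show ?thesis
      unfolding P_def set_sorted_paths[of \<xi>, symmetric] by (rule nth_mem)
  qed
  have len: "length (P n) = n" if "k \<le> n" for n
    using length_paths_to[OF P_in[OF that]] scheme_level[OF that] by (simp add: u_def)
  have step: "P (Suc n) = P n @ [(u n, u (Suc n))]" if "k \<le> n" for n
    using scheme_prefix[of "Suc n" "I (Suc n)" m "I n"] I[of n] I[of "Suc n"] that
    by (simp add: P_def u_def)
  have stable: "P (n + d) ! j = P n ! j" if "k \<le> n" "j < n" for n d j
  proof (induction d)
    case (Suc d)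
    then show ?case using step[of "n + d"] len[of "n + d"] that by (simp add: nth_append)
  qed simp
  have P_nth: "P n ! j = \<gamma> j" if "k \<le> n" "j < n" for n j
    using stable[of "max k (Suc j)" j "n - max k (Suc j)"] that by (simp add: \<gamma>_def)
  have seg: "initial_segment n \<gamma> = P n" if "k \<le> n" for n
    by (rule nth_equalityI) (use that len P_nth in \<open>simp_all add: initial_segment_def\<close>)
  have walkD: "is_edge (es ! j) \<and> (Suc j < length es \<longrightarrow> fst (es ! Suc j) = snd (es ! j))"
    if "walk a es b" "j < length es" for a b es j
    using that
  proof (induction es arbitrary: a j)
    case (Cons e es)
    then show ?case by (cases j; cases es) fastforce+
  qed simp
  have "\<gamma> \<in> path_space"
  proof -
    have "is_edge (\<gamma> n) \<and> fst (\<gamma> (Suc n)) = snd (\<gamma> n)" for n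
    proof -
      let ?N = "max k (Suc (Suc n))"
      have "walk (0, 0) (P ?N) (u ?N)" using P_in[of ?N] by (simp add: paths_to_def)
      then show ?thesis
        using walkD[of "(0, 0)" "P ?N" "u ?N" n] len[of ?N] P_nth[of ?N n] P_nth[of ?N "Suc n"] by simp
    qed
    moreover have "fst (\<gamma> 0) = (0, 0)"
    proof -
      let ?N = "max k 1"
      have "walk (0, 0) (P ?N) (u ?N)" using P_in[of ?N] by (simp add: paths_to_def)
      then show ?thesis
        using len[of ?N] P_nth[of ?N 0] by (cases "P ?N") auto
    qed
    ultimately show ?thesis by (simp add: path_space_def)
  qed
  then have "is_orbit_path \<xi> k S m \<gamma>"
    unfolding is_orbit_path_def using I seg by (auto simp: P_def u_def)
  then show "\<exists>\<gamma>. is_orbit_path \<xi> k S m \<gamma>" by blast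
next
  fix \<gamma> \<eta>
  assume *: "is_orbit_path \<xi> k S m \<gamma>" "is_orbit_path \<xi> k S m \<eta>"
  have eq: "initial_segment n \<gamma> = initial_segment n \<eta>" if "k \<le> n" for n
    using * that covers_unique[OF scheme_mono[OF that]] unfolding is_orbit_path_def by metis
  show "\<gamma> = \<eta>"
  proof
    fix j
    have "initial_segment (max k (Suc j)) \<gamma> ! j = initial_segment (max k (Suc j)) \<eta> ! j"
      using eq[of "max k (Suc j)"] by simp
    then show "\<gamma> j = \<eta> j" by (simp add: initial_segment_def)
  qed
qed

lemma is_orbit_path_orbit: "is_orbit_path \<xi> k S m (orbit \<xi> k S m)"
  unfolding orbit_def using is_orbit_path_ex1 by (rule theI')

lemma orbit_in_path_space: "orbit \<xi> k S m \<in> path_space"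
  using is_orbit_path_orbit unfolding is_orbit_path_def by blast

lemma initial_segment_orbit:
  assumes "k \<le> n" "covers S n i m"
  shows "initial_segment n (orbit \<xi> k S m) = sorted_paths \<xi> (vert S n i) ! nat (m - cut_point S n i)"
  using is_orbit_path_orbit[of m] assms covers_unique[OF scheme_mono[OF assms(1)]]
  unfolding is_orbit_path_def by metis

lemma orbit_edge:
  assumes "k \<le> n" "covers S n i m" "covers S (Suc n) j m"
  shows "orbit \<xi> k S m n = (vert S n i, vert S (Suc n) j)"
proof -
  have "initial_segment (Suc n) (orbit \<xi> k S m) =
      initial_segment n (orbit \<xi> k S m) @ [(vert S n i, vert S (Suc n) j)]"
    using scheme_prefix[of "Suc n" j m i] initial_segment_orbit[of "Suc n" j m]
      initial_segment_orbit[of n i m] assms by simp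
  then show ?thesis by (simp add: initial_segment_def)
qed

lemma covers_lift:
  assumes n: "k \<le> n" and i: "covers S n i m" "covers S n i (m + 1)"
  shows "\<exists>j. covers S (Suc n) j m \<and> covers S (Suc n) j (m + 1)"
proof -
  obtain j where j: "covers S (Suc n) j m"
    using covers_exists[OF scheme_mono] n by (metis le_SucI)
  obtain x y where v: "vert S (Suc n) j = (x, y)" by (cases "vert S (Suc n) j")
  have xy: "x + y = Suc n" using scheme_level[of "Suc n" j] n v by simp
  have "\<exists>i'. cut_point S n i' = cut_point S (Suc n) (j + 1)"
    using cs n v xy unfolding consistent_scheme_def
    by (metis (no_types, lifting) One_nat_def Suc_leI diff_Suc_1 gr0I le_imp_less_Suc)
  then obtain i' where i': "cut_point S n i' = cut_point S (Suc n) (j + 1)" by blast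
  have "cut_point S n i < cut_point S n i'"
    using i(1) j unfolding covers_def i' by linarith
  then have "cut_point S n (i + 1) \<le> cut_point S n i'"
    using scheme_mono[OF n] by (simp add: strict_mono_less strict_mono_less_eq)
  then have "covers S (Suc n) j (m + 1)"
    using i(2) j unfolding covers_def i' by linarith
  then show ?thesis using j by blast
qed

lemma adic_orbit:
  assumes n: "k \<le> n" and i: "covers S n i m" "covers S n i (m + 1)"
  shows "adic \<xi> (orbit \<xi> k S m) = orbit \<xi> k S (m + 1)"
proof -
  let ?A = "orbit \<xi> k S m" and ?B = "orbit \<xi> k S (m + 1)"
  have common: "\<exists>j. covers S N j m \<and> covers S N j (m + 1)" if "n \<le> N" for N
    using that by (induction N rule: dec_induct) (use i covers_lift n in \<open>auto dest: order_trans\<close>)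
  have tail: "?A N = ?B N" if N: "n \<le> N" for N
  proof -
    obtain j j' where "covers S N j m" "covers S N j (m + 1)"
        "covers S (Suc N) j' m" "covers S (Suc N) j' (m + 1)"
      using common[OF N] common[OF le_SucI[OF N]] by blast
    then show ?thesis using orbit_edge[of N j _ j'] n N by simp
  qed
  have lift: "infinite_path_less \<xi> \<gamma> \<eta>"
    if less: "path_less \<xi> (initial_segment N \<gamma>) (initial_segment N \<eta>)" and eq: "\<And>q. N \<le> q \<Longrightarrow> \<gamma> q = \<eta> q" for N \<gamma> \<eta>
  proof -
    obtain p where "p < N" "edge_less \<xi> (\<gamma> p) (\<eta> p)" "\<And>q. p < q \<Longrightarrow> q < N \<Longrightarrow> \<gamma> q = \<eta> q"
      using less unfolding path_less_def by (auto simp: initial_segment_def)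
    then show ?thesis
      using eq unfolding infinite_path_less_def by (metis linorder_not_less)
  qed
  have sorted: "path_less \<xi> (sorted_paths \<xi> v ! p) (sorted_paths \<xi> v ! q)"
    if "p < q" "q < length (sorted_paths \<xi> v)" for p q v
    using sorted_paths_props(1)[of \<xi> v] that sorted_wrt_nth_less by blast
  have walk_seg: "walk (0, 0) (initial_segment (Suc N) \<zeta>) (snd (\<zeta> N))" if "\<zeta> \<in> path_space" for N \<zeta>
    by (induction N) (use that in \<open>simp_all add: path_space_def initial_segment_def walk_append\<close>)
  have asym: "\<not> infinite_path_less \<xi> \<eta> \<gamma>" if "infinite_path_less \<xi> \<gamma> \<eta>" for \<gamma> \<eta>
    using that edge_less_asym unfolding infinite_path_less_def by (metis linorder_neqE_nat)
  have segs: "\<exists>v r. initial_segment N ?A = sorted_paths \<xi> v ! r \<and>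
      initial_segment N ?B = sorted_paths \<xi> v ! Suc r \<and> Suc r < length (sorted_paths \<xi> v) \<and>
      (\<forall>N'. N = Suc N' \<longrightarrow> snd (?A N') = v)"
    if N: "n \<le> N" for N
  proof -
    obtain j where j: "covers S N j m" "covers S N j (m + 1)" using common[OF N] by blast
    have kN: "k \<le> N" using n N by simp
    define r where "r = nat (m - cut_point S N j)"
    have r: "nat (m + 1 - cut_point S N j) = Suc r"
      using j unfolding r_def covers_def by linarith
    have len: "Suc r < length (sorted_paths \<xi> (vert S N j))"
      using scheme_length[OF kN, of j] j r unfolding covers_def by linarith
    have A: "initial_segment N ?A = sorted_paths \<xi> (vert S N j) ! r"
      using initial_segment_orbit[OF kN j(1)] by (simp add: r_def)
    then have "initial_segment N ?A \<in> paths_to (vert S N j)"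
      using len set_sorted_paths[of \<xi> "vert S N j"] by (metis Suc_lessD nth_mem)
    then have "snd (?A N') = vert S N j" if "N = Suc N'" for N'
      using that by (simp add: initial_segment_def snoc_in_paths_to)
    then show ?thesis
      using A len initial_segment_orbit[OF kN j(2)] r by metis
  qed
  have less: "infinite_path_less \<xi> ?A ?B"
  proof (rule lift[of n])
    show "path_less \<xi> (initial_segment n ?A) (initial_segment n ?B)"
      using segs[OF order_refl] sorted by (metis lessI)
  qed (rule tail)
  have least: "\<zeta> = ?B \<or> infinite_path_less \<xi> ?B \<zeta>"
    if \<zeta>: "\<zeta> \<in> path_space" "infinite_path_less \<xi> ?A \<zeta>" for \<zeta>
  proof -
    obtain p where p: "edge_less \<xi> (?A p) (\<zeta> p)" "\<And>q. p < q \<Longrightarrow> ?A q = \<zeta> q"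
      using \<zeta>(2) unfolding infinite_path_less_def by blast
    define N where "N = Suc (max n p)"
    have N: "n \<le> N" "p < N" by (auto simp: N_def)
    obtain v r where v: "initial_segment (Suc N) ?A = sorted_paths \<xi> v ! r"
        "initial_segment (Suc N) ?B = sorted_paths \<xi> v ! Suc r"
        "Suc r < length (sorted_paths \<xi> v)" "snd (?A N) = v"
      using segs[of "Suc N"] N by auto
    have tail': "?B q = \<zeta> q" if "N \<le> q" for q
      using p(2)[of q] tail[of q] that N by simp
    have "initial_segment (Suc N) \<zeta> \<in> set (sorted_paths \<xi> v)"
      using walk_seg[OF \<zeta>(1), of N] p(2)[OF N(2)] v(4) by (simp add: set_sorted_paths paths_to_def)
    then obtain s where s: "s < length (sorted_paths \<xi> v)" "initial_segment (Suc N) \<zeta> = sorted_paths \<xi> v ! s"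
      by (metis in_set_conv_nth)
    have "path_less \<xi> (initial_segment (Suc N) ?A) (initial_segment (Suc N) \<zeta>)"
      unfolding path_less_def
      by (intro conjI exI[of _ p])
        (use p N in \<open>auto simp: initial_segment_def nth_append less_Suc_eq\<close>)
    then have "r < s"
      using sorted[of s r v] path_less_asym v s by (metis Suc_lessD linorder_neqE_nat)
    then consider "s = Suc r" | "Suc r < s" by linarith
    then show ?thesis
    proof cases
      case 1
      then have eq: "initial_segment (Suc N) \<zeta> = initial_segment (Suc N) ?B" using v s by simp
      have "\<zeta> q = ?B q" for q
      proof (cases "N \<le> q")
        case False
        then have "initial_segment (Suc N) \<zeta> ! q = \<zeta> q" "initial_segment (Suc N) ?B ! q = ?B q"
          by (simp_all add: initial_segment_def nth_append)
        then show ?thesis using eq by simp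
      qed (simp add: tail')
      then show ?thesis by blast
    next
      case 2
      then show ?thesis
        using sorted[OF 2 s(1)] v s tail' lift[of "Suc N" ?B \<zeta>] by simp
    qed
  qed
  show ?thesis
    unfolding adic_def
  proof (rule the_equality)
    fix \<eta>
    assume "\<eta> \<in> path_space \<and> infinite_path_less \<xi> ?A \<eta> \<and>
      (\<forall>\<zeta>\<in>path_space. infinite_path_less \<xi> ?A \<zeta> \<longrightarrow> \<zeta> = \<eta> \<or> infinite_path_less \<xi> \<eta> \<zeta>)"
    then show "\<eta> = ?B"
      using least[of \<eta>] less asym orbit_in_path_space by blast
  qed (use less least orbit_in_path_space in blast)
qed

end

end

theory Submission
  imports Defs
begin

text \<open>
The $3$-coding gives the first three edges of every point of an orbit. The proof shows, by
induction on $n \ge 3$, that two orbits with equal initial segments of length $n$ at every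
coordinate also have equal initial segments of length $n + 1$; then the paths at coordinate
$0$ are equal.

The initial segments of length $n$ show how the coordinates are cut into blocks of level $n$ and
which vertex each block has. To go on to level $n + 1$, it must be known how these blocks are
grouped. Write a vertex $(x, n - x)$ as the letter $x$. A block of level $n + 1$ with letter $j$ is
the single letter $0$ (if $j = 0$), the single letter $n$ (if $j = n + 1$), or else one pair of
neighbours with letters $j - 1$ and $j$, in the order that the ordering prescribes at that vertex.
The partner of a block in such a pair is its mate (lemma \<open>mate\<close>).

Suppose that the two orbits group the blocks of level $n$ differently at some block. If one orbit
pairs this block with its mate and the other does not, then the other orbit does not pair the mate
with it either, so the groupings also differ at the mate (\<open>mate_disagree\<close>). At such
a block with letter $x \ge 1$, exactly one of the two orbits pairs it with a mate of letter $x - 1$. So the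
disagreement can be moved down to a block with letter $0$. There one orbit has a
single $0$, and the other pairs it with a neighbour of letter $1$. Passing to mates alternately in
the two orbits never turns back, because the letters increase, and gives adjacent blocks
$0, 1, 2, 3$, read in one of the two directions, grouped as

  \<^item> $(0\,1)\,(2\,3)$ in one orbit,
  \<^item> $(0)\,(1\,2)\,(3\,\cdots$ in the other, with letters $0, 2, 4$ at level $n + 1$.

This uses $n \ge 3$. In the second orbit, the block with letter $2$ at level $n + 1$ is not an end
letter, so it must be paired at level $n + 2$ with a neighbour of letter $1$ or $3$. But its neighbours have
letters $0$ and $4$ (\<open>no_disagreement_at_left_boundary\<close>).

A factoring scheme describes blocks of level at least $k$ only, and $k$ may exceed $3$. Blocks are
therefore described by the paths alone: the position of a path within its level-$n$ block is
its rank among the paths to its level-$n$ vertex, and passing to the next coordinate raises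
this rank by one or else leaves a maximal path for a minimal one (\<open>follows\<close>). This property is
inherited by lower levels, hence it holds at all levels (\<open>orbit_follows\<close>).
\<close>

section \<open>Ranks of initial segments\<close>

definition inner :: "vertex \<Rightarrow> bool" where
  "inner w \<longleftrightarrow> fst w \<ge> 1 \<and> snd w \<ge> 1"

definition first_source :: "ordering \<Rightarrow> vertex \<Rightarrow> vertex" where
  "first_source \<xi> w = (if \<xi> w then (fst w - 1, snd w) else (fst w, snd w - 1))"

definition second_source :: "ordering \<Rightarrow> vertex \<Rightarrow> vertex" where
  "second_source \<xi> w = (if \<xi> w then (fst w, snd w - 1) else (fst w - 1, snd w))"

abbreviation width :: "ordering \<Rightarrow> vertex \<Rightarrow> nat" where
  "width \<xi> v \<equiv> length (sorted_paths \<xi> v)"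

lemma sources_distinct: "inner w \<Longrightarrow> first_source \<xi> w \<noteq> second_source \<xi> w"
  by (cases w) (auto simp: inner_def first_source_def second_source_def)

lemma inner_edge_cases:
  "is_edge (v, w) \<Longrightarrow> inner w \<Longrightarrow> v = first_source \<xi> w \<or> v = second_source \<xi> w"
  by (auto simp: is_edge_def inner_def first_source_def second_source_def)

lemma sorted_paths_inner:
  assumes "inner w"
  shows "sorted_paths \<xi> w =
    map (\<lambda>p. p @ [(first_source \<xi> w, w)]) (sorted_paths \<xi> (first_source \<xi> w)) @
    map (\<lambda>p. p @ [(second_source \<xi> w, w)]) (sorted_paths \<xi> (second_source \<xi> w))"
proof -
  obtain x y where "w = (Suc x, Suc y)"
    using assms by (cases w) (metis One_nat_def Suc_le_D fst_conv snd_conv inner_def)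
  then show ?thesis
    by (cases "\<xi> w") (simp_all add: first_source_def second_source_def sorted_paths_1 sorted_paths_0)
qed

lemma sorted_paths_boundary:
  assumes "is_edge (v, w)" "\<not> inner w"
  shows "sorted_paths \<xi> w = map (\<lambda>p. p @ [(v, w)]) (sorted_paths \<xi> v)"
  using assms by (auto simp: is_edge_def inner_def not_less_eq_eq sorted_paths_bottom sorted_paths_left)

lemma width_pos: "0 < width \<xi> v"
proof -
  have "0 < width \<xi> (x, y)" for x y
  proof (induction x arbitrary: y)
    case 0
    then show ?case by (metis length_sorted_paths_boundary(2) zero_less_one)
  next
    case (Suc x)
    then show ?case
      by (cases y; cases "\<xi> (Suc x, y)") (auto simp: sorted_paths_bottom sorted_paths_1 sorted_paths_0)
  qed
  then show ?thesis by (cases v) auto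
qed

lemma sorted_paths_nonempty [simp]: "sorted_paths \<xi> v \<noteq> []"
  using width_pos[of \<xi> v] by simp

lemma width_inner:
  "inner w \<Longrightarrow> width \<xi> w = width \<xi> (first_source \<xi> w) + width \<xi> (second_source \<xi> w)"
  by (simp add: sorted_paths_inner)

text \<open>The number of paths to the target of an edge that are smaller than all the paths ending with
that edge.\<close>

definition skipped :: "ordering \<Rightarrow> edge \<Rightarrow> nat" where
  "skipped \<xi> e = (if inner (snd e) \<and> fst e = second_source \<xi> (snd e)
     then width \<xi> (first_source \<xi> (snd e)) else 0)"

definition rank :: "ordering \<Rightarrow> (nat \<Rightarrow> edge) \<Rightarrow> nat \<Rightarrow> nat" where
  "rank \<xi> \<gamma> n = (\<Sum>i<n. skipped \<xi> (\<gamma> i))"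

lemma rank_Suc: "rank \<xi> \<gamma> (Suc n) = rank \<xi> \<gamma> n + skipped \<xi> (\<gamma> n)"
  by (simp add: rank_def)

lemma sorted_paths_nth_skipped:
  assumes "is_edge (v, w)" "r < width \<xi> v"
  shows "r + skipped \<xi> (v, w) < width \<xi> w \<and>
    sorted_paths \<xi> w ! (r + skipped \<xi> (v, w)) = sorted_paths \<xi> v ! r @ [(v, w)]"
proof (cases "inner w")
  case True
  then show ?thesis
    using inner_edge_cases[OF assms(1) True, of \<xi>] assms(2) sources_distinct[OF True, of \<xi>]
    by (auto simp: skipped_def sorted_paths_inner nth_append)
next
  case False
  then show ?thesis
    using assms sorted_paths_boundary[OF assms(1) False, of \<xi>] by (simp add: skipped_def)
qed

lemma path_space_edge: "\<gamma> \<in> path_space \<Longrightarrow> \<gamma> n = (fst (\<gamma> n), fst (\<gamma> (Suc n)))"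
  and path_space_is_edge: "\<gamma> \<in> path_space \<Longrightarrow> is_edge (fst (\<gamma> n), fst (\<gamma> (Suc n)))"
  by (auto simp: path_space_def)

text \<open>The sum in the definition of \<open>rank\<close> is the position of the initial segment: the paths to an inner
vertex are listed with those through the smaller edge first, so extending a path by one edge shifts
its position by what this edge skips.\<close>

lemma nth_rank:
  assumes "\<gamma> \<in> path_space"
  shows "rank \<xi> \<gamma> n < width \<xi> (fst (\<gamma> n)) \<and>
    sorted_paths \<xi> (fst (\<gamma> n)) ! rank \<xi> \<gamma> n = initial_segment n \<gamma>"
proof (induction n)
  case 0
  then show ?case
    using assms by (simp add: path_space_def rank_def initial_segment_def sorted_paths_root)
next
  case (Suc n)
  then show ?case
    using sorted_paths_nth_skipped[OF path_space_is_edge[OF assms, of n], of "rank \<xi> \<gamma> n" \<xi>]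
    by (simp add: rank_Suc path_space_edge[OF assms, of n, symmetric])
       (simp add: initial_segment_def)
qed

lemmas rank_less = nth_rank[THEN conjunct1]

lemma distinct_sorted_paths: "distinct (sorted_paths \<xi> v)"
proof -
  have "path_less \<xi> (sorted_paths \<xi> v ! i) (sorted_paths \<xi> v ! j)" if "i < j" "j < width \<xi> v" for i j
    using sorted_paths_props(1)[of \<xi> v] that sorted_wrt_nth_less by blast
  then show ?thesis
    unfolding distinct_conv_nth using path_less_asym by (metis linorder_neqE_nat)
qed

lemma same_segment_vertex:
  assumes "\<gamma> \<in> path_space" "\<eta> \<in> path_space" "initial_segment n \<gamma> = initial_segment n \<eta>"
  shows "fst (\<gamma> n) = fst (\<eta> n)"
proof (cases n)
  case 0
  then show ?thesis using assms by (simp add: path_space_def)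
next
  case (Suc j)
  then have "\<gamma> j = \<eta> j" using assms(3) by (simp add: initial_segment_def)
  then show ?thesis
    using assms(1,2) Suc by (simp add: path_space_def)
qed

lemma same_segment_rank:
  assumes "initial_segment n \<gamma> = initial_segment n \<eta>"
  shows "rank \<xi> \<gamma> n = rank \<xi> \<eta> n"
  using assms by (auto simp: rank_def initial_segment_def intro!: sum.cong)

section \<open>Orbits move through blocks at every level\<close>

text \<open>The second alternative says nothing about the vertex of \<open>\<eta>\<close>: after the last path of a block, any
block may start.\<close>

definition follows :: "ordering \<Rightarrow> nat \<Rightarrow> (nat \<Rightarrow> edge) \<Rightarrow> (nat \<Rightarrow> edge) \<Rightarrow> bool" where
  "follows \<xi> n \<gamma> \<eta> \<longleftrightarrow>
     fst (\<eta> n) = fst (\<gamma> n) \<and> rank \<xi> \<eta> n = Suc (rank \<xi> \<gamma> n) \<or>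
     Suc (rank \<xi> \<gamma> n) = width \<xi> (fst (\<gamma> n)) \<and> rank \<xi> \<eta> n = 0"

text \<open>A successor at level \<open>Suc n\<close> either keeps the incoming edge and advances below it, or passes
from the last path through the smaller edge to the first path through the larger one, or crosses from a
last to a first path. Each of these is a successor at level \<open>n\<close>.\<close>

lemma follows_lower_level:
  assumes \<gamma>: "\<gamma> \<in> path_space" and \<eta>: "\<eta> \<in> path_space" and f: "follows \<xi> (Suc n) \<gamma> \<eta>"
  shows "follows \<xi> n \<gamma> \<eta>"
proof -
  define w where "w = fst (\<gamma> (Suc n))"
  note less = rank_less[OF \<gamma>, of \<xi> n] rank_less[OF \<eta>, of \<xi> n]
    rank_less[OF \<gamma>, of \<xi> "Suc n"] rank_less[OF \<eta>, of \<xi> "Suc n"]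
  have e: "is_edge (fst (\<gamma> n), w)" using path_space_is_edge[OF \<gamma>] by (simp add: w_def)
  have sk: "rank \<xi> \<gamma> (Suc n) = rank \<xi> \<gamma> n + skipped \<xi> (fst (\<gamma> n), w)"
    "rank \<xi> \<eta> (Suc n) = rank \<xi> \<eta> n + skipped \<xi> (fst (\<eta> n), fst (\<eta> (Suc n)))"
    using path_space_edge[OF \<gamma>, of n] path_space_edge[OF \<eta>, of n] by (simp_all add: rank_Suc w_def)
  consider (inside) "fst (\<eta> (Suc n)) = w" "rank \<xi> \<eta> (Suc n) = Suc (rank \<xi> \<gamma> (Suc n))"
    | (last) "Suc (rank \<xi> \<gamma> (Suc n)) = width \<xi> w" "rank \<xi> \<eta> (Suc n) = 0"
    using f unfolding follows_def w_def by metis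
  then show ?thesis
  proof cases
    case inside
    have e': "is_edge (fst (\<eta> n), w)" using path_space_is_edge[OF \<eta>, of n] inside by simp
    show ?thesis
    proof (cases "inner w")
      case True
      then show ?thesis
        using inner_edge_cases[OF e True, of \<xi>] inner_edge_cases[OF e' True, of \<xi>]
          sources_distinct[OF True, of \<xi>] width_inner[OF True, of \<xi>] less sk inside
        unfolding follows_def by (auto simp: skipped_def w_def)
    next
      case False
      then have "fst (\<gamma> n) = fst (\<eta> n)"
        using e e' by (auto simp: is_edge_def inner_def)
      then show ?thesis
        using sk inside unfolding follows_def by simp
    qed
  next
    case last
    have "Suc (rank \<xi> \<gamma> n) = width \<xi> (fst (\<gamma> n))"
    proof (cases "inner w")
      case True
      have "1 \<le> width \<xi> (second_source \<xi> w)"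
        using width_pos[of \<xi> "second_source \<xi> w"] by linarith
      then show ?thesis
        using inner_edge_cases[OF e True, of \<xi>]
          sources_distinct[OF True, of \<xi>] width_inner[OF True, of \<xi>] less(1) sk(1) last(1) True
        by (auto simp: skipped_def)
    next
      case False
      then show ?thesis
        using sorted_paths_boundary[OF e False, of \<xi>] last sk by (simp add: skipped_def)
    qed
    then show ?thesis using last sk unfolding follows_def by simp
  qed
qed

text \<open>From level \<open>k\<close> on, the rank is the offset in the covering block of the scheme; below level \<open>k\<close>
the property is inherited from above.\<close>

lemma orbit_follows:
  assumes cs: "consistent_scheme \<xi> k \<omega> S"
  shows "follows \<xi> n (orbit \<xi> k S m) (orbit \<xi> k S (m + 1))"
proof -
  let ?\<gamma> = "orbit \<xi> k S"
  have path: "?\<gamma> m \<in> path_space" for m by (rule orbit_in_path_space[OF cs])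
  have at: "fst (?\<gamma> m N) = vert S N i \<and> rank \<xi> (?\<gamma> m) N = nat (m - cut_point S N i)"
    if N: "k \<le> N" and c: "covers S N i m" for N i m
  proof -
    obtain j where "covers S (Suc N) j m"
      using covers_exists[OF scheme_mono[OF cs]] N by (metis le_SucI)
    then have v: "fst (?\<gamma> m N) = vert S N i"
      using orbit_edge[OF cs N c] by simp
    have "nat (m - cut_point S N i) < width \<xi> (vert S N i)"
      using scheme_length[OF cs N, of i] c unfolding covers_def by linarith
    then have "rank \<xi> (?\<gamma> m) N = nat (m - cut_point S N i)"
      using nth_rank[OF path, of \<xi> m N] initial_segment_orbit[OF cs N c] v
        nth_eq_iff_index_eq[OF distinct_sorted_paths] by metis
    then show ?thesis using v by simp
  qed
  have high: "follows \<xi> N (?\<gamma> m) (?\<gamma> (m + 1))" if N: "k \<le> N" for N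
  proof -
    obtain i where i: "covers S N i m"
      using covers_exists[OF scheme_mono[OF cs N]] by blast
    show ?thesis
    proof (cases "m + 1 < cut_point S N (i + 1)")
      case True
      then have "covers S N i (m + 1)" using i by (simp add: covers_def)
      then show ?thesis
        using at[OF N i] at[OF N, of i "m + 1"] i by (auto simp: follows_def covers_def)
    next
      case False
      then have m: "m + 1 = cut_point S N (i + 1)" using i by (simp add: covers_def)
      then have "covers S N (i + 1) (m + 1)"
        using strict_monoD[OF scheme_mono[OF cs N], of "i + 1" "i + 1 + 1"] by (simp add: covers_def)
      then show ?thesis
        using at[OF N i] at[OF N, of "i + 1" "m + 1"] m i scheme_length[OF cs N, of i]
        by (auto simp: follows_def covers_def)
    qed
  qed
  show ?thesis
  proof (cases "k \<le> n")
    case True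
    then show ?thesis by (rule high)
  next
    case False
    then have "n \<le> k" by simp
    then show ?thesis
      by (induction n rule: inc_induct) (use high follows_lower_level[OF path path] in auto)
  qed
qed


section \<open>Neighbouring blocks and mates\<close>

text \<open>The blocks of level \<open>n\<close> of such a bi-infinite sequence of paths are the intervals that begin at the coordinates
of rank \<open>0\<close>; they are represented by these first coordinates.\<close>

locale adic_line =
  fixes \<xi> :: ordering and G :: "int \<Rightarrow> nat \<Rightarrow> edge"
  assumes path: "G m \<in> path_space"
    and succ: "follows \<xi> n (G m) (G (m + 1))"
begin

abbreviation V :: "nat \<Rightarrow> int \<Rightarrow> vertex" where
  "V n m \<equiv> fst (G m n)"

abbreviation R :: "nat \<Rightarrow> int \<Rightarrow> nat" where
  "R n m \<equiv> rank \<xi> (G m) n"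

text \<open>The flag \<open>d\<close> tells whether the neighbour is on the right or on the left. Keeping it as a
parameter lets one argument serve both orders in which a pair can be arranged.\<close>

definition nbr :: "nat \<Rightarrow> bool \<Rightarrow> int \<Rightarrow> int \<Rightarrow> bool" where
  "nbr n d s t \<longleftrightarrow> R n s = 0 \<and> R n t = 0 \<and>
     (if d then t = s + int (width \<xi> (V n s)) else s = t + int (width \<xi> (V n t)))"

definition block_start :: "nat \<Rightarrow> int \<Rightarrow> int" where
  "block_start n m = m - int (R n m)"

lemma R_less: "R n m < width \<xi> (V n m)"
  by (rule rank_less[OF path])

lemma is_edge_V: "is_edge (V n m, V (Suc n) m)"
  by (rule path_space_is_edge[OF path])

lemma R_Suc: "R (Suc n) m = R n m + skipped \<xi> (V n m, V (Suc n) m)"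
  using path_space_edge[OF path] by (metis rank_Suc)

lemma forward: "R n m + j < width \<xi> (V n m) \<Longrightarrow> V n (m + int j) = V n m \<and> R n (m + int j) = R n m + j"
proof (induction j)
  case (Suc j)
  then show ?case
    using succ[of n "m + int j"] by (simp add: follows_def add.assoc add.commute[of 1])
qed simp

lemma backward: "j \<le> R n m \<Longrightarrow> V n (m - int j) = V n m \<and> R n (m - int j) = R n m - j"
proof (induction j)
  case (Suc j)
  then show ?case
    using succ[of n "m - int (Suc j)"] by (auto simp: follows_def)
qed simp

lemma V_block_start: "V n (block_start n m) = V n m"
  and R_block_start: "R n (block_start n m) = 0"
  using backward[of "R n m" m n] by (simp_all add: block_start_def)

lemma R_next: "R n s = 0 \<Longrightarrow> R n (s + int (width \<xi> (V n s))) = 0"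
  using forward[of s n "width \<xi> (V n s) - 1"] width_pos[of \<xi> "V n s"]
    succ[of n "s + int (width \<xi> (V n s) - 1)"] R_less[of "s + int (width \<xi> (V n s))" n]
  by (auto simp: follows_def of_nat_diff Suc_le_eq)

lemma nbr_sym: "nbr n d s t \<longleftrightarrow> nbr n (\<not> d) t s"
  by (auto simp: nbr_def)

lemma nbr_unique:
  assumes "nbr n d s t" "nbr n d s t'"
  shows "t = t'"
proof (cases d)
  case True
  then show ?thesis using assms by (simp add: nbr_def)
next
  case False
  have "\<not> a < b" if "nbr n False s a" "nbr n False s b" for a b
  proof
    assume "a < b"
    define j where "j = nat (b - a)"
    have j: "b = a + int j" "j \<noteq> 0" using \<open>a < b\<close> by (auto simp: j_def)
    have "j < width \<xi> (V n a)"
      using that j width_pos[of \<xi> "V n b"] unfolding nbr_def by (simp del: length_greater_0_conv)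
    then show False
      using forward[of a n j] that j unfolding nbr_def by simp
  qed
  then show ?thesis using assms False by (metis linorder_neqE_linordered_idom)
qed

text \<open>Blocks of level \<open>n + 1\<close> are unions of blocks of level \<open>n\<close>, because the rank never decreases with
the level.\<close>

lemma V_Suc_block_start: "V (Suc n) (block_start n m) = V (Suc n) m"
  and block_start_Suc: "block_start (Suc n) (block_start n m) = block_start (Suc n) m"
  using backward[of "R n m" m "Suc n"] by (auto simp: R_Suc[of m n] block_start_def)

lemma block_start_eqI:
  assumes "R n s = 0" "s \<le> m" "m < s + int (width \<xi> (V n s))"
  shows "block_start n m = s"
  using forward[of s n "nat (m - s)"] assms by (simp add: block_start_def)

text \<open>A block of level \<open>n + 1\<close> with an inner vertex consists of two blocks of level \<open>n\<close>. The rank at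
level \<open>n + 1\<close> of the first coordinate of each half is \<open>0\<close> or the width of the first half, and moving by
that width leads to the other half. The side \<open>d\<close> on which the mate lies depends only on the vertex of
the block and that of the pair; so if the mate had the same pair vertex in another
grouping, its mate there would be the original block.\<close>

lemma mate:
  assumes s: "R n s = 0" and w: "inner (V (Suc n) s)"
  obtains t d where "nbr n d s t" "V (Suc n) t = V (Suc n) s"
    "block_start (Suc n) t = block_start (Suc n) s"
    "{V n s, V n t} = {first_source \<xi> (V (Suc n) s), second_source \<xi> (V (Suc n) s)}"
    "V n t \<noteq> V n s" "d \<longleftrightarrow> V n s = first_source \<xi> (V (Suc n) s)"
proof -
  define w a b where "w = V (Suc n) s" and "a = first_source \<xi> w" and "b = second_source \<xi> w"
  have W: "width \<xi> w = width \<xi> a + width \<xi> b" and ab: "a \<noteq> b"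
    using width_inner[of w \<xi>] sources_distinct[of w \<xi>] w by (simp_all add: w_def a_def b_def)
  have pos: "0 < width \<xi> a" "0 < width \<xi> b" by (simp_all add: width_pos)
  have sk: "skipped \<xi> (V n m, V (Suc n) m) = (if V n m = b then width \<xi> a else 0)"
    and src: "V n m = a \<or> V n m = b" if "V (Suc n) m = w" for m
    using w that inner_edge_cases[of "V n m" w \<xi>] is_edge_V[of m n]
    by (simp_all add: skipped_def w_def a_def b_def)
  have Rs: "R (Suc n) m = R n m + (if V n m = b then width \<xi> a else 0)" if "V (Suc n) m = w" for m
    using R_Suc sk[OF that] by simp
  show ?thesis
  proof (cases "V n s = a")
    case True
    define t where "t = s + int (width \<xi> a)"
    have 0: "R (Suc n) s = 0" using Rs[of s] s True ab by (simp add: w_def)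
    then have t: "V (Suc n) t = w" "R (Suc n) t = width \<xi> a"
      using forward[of s "Suc n" "width \<xi> a"] pos W by (simp_all add: t_def w_def)
    have "R n t = 0" using R_next[OF s] True by (simp add: t_def)
    then have "V n t = b" using Rs[OF t(1)] t(2) pos by (auto split: if_splits)
    then show ?thesis
      using that[of True t] True s t \<open>R n t = 0\<close> 0 ab
      by (simp add: nbr_def t_def block_start_def w_def a_def b_def)
  next
    case False
    then have b: "V n s = b" using src[of s] by (simp add: w_def)
    define t where "t = s - int (width \<xi> a)"
    have 0: "R (Suc n) s = width \<xi> a" using Rs[of s] s b by (simp add: w_def)
    then have t: "V (Suc n) t = w" "R (Suc n) t = 0"
      using backward[of "width \<xi> a" s "Suc n"] by (simp_all add: t_def w_def)
    then have "R n t = 0" "V n t = a"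
      using Rs[OF t(1)] src[OF t(1)] pos by (auto split: if_splits)
    then show ?thesis
      using that[of False t] b s t 0 ab
      by (simp add: nbr_def t_def block_start_def w_def a_def b_def insert_commute)
  qed
qed

text \<open>If neighbouring blocks have different vertices one level up, then the boundary between them is a
boundary of that level too.\<close>

lemma nbr_Suc:
  assumes "nbr n d s t" and ne: "V (Suc n) s \<noteq> V (Suc n) t"
  shows "nbr (Suc n) d (block_start (Suc n) s) (block_start (Suc n) t)"
proof -
  have *: "nbr (Suc n) True (block_start (Suc n) s) (block_start (Suc n) t)"
    if nb: "nbr n True s t" and ne: "V (Suc n) s \<noteq> V (Suc n) t" for s t
  proof -
    have t: "t = s + int (width \<xi> (V n s))" and s0: "R n s = 0" using nb by (simp_all add: nbr_def)
    have "block_start n (t - 1) = s"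
      using block_start_eqI[OF s0, of "t - 1"] t width_pos[of \<xi> "V n s"] by simp
    then have u: "V (Suc n) (t - 1) = V (Suc n) s" "block_start (Suc n) (t - 1) = block_start (Suc n) s"
      using V_Suc_block_start[of n "t - 1"] block_start_Suc[of n "t - 1"] by simp_all
    then have "Suc (R (Suc n) (t - 1)) = width \<xi> (V (Suc n) s)" "R (Suc n) t = 0"
      using succ[of "Suc n" "t - 1"] ne by (auto simp: follows_def)
    then show ?thesis
      using u R_block_start[of "Suc n" s] V_block_start[of "Suc n" s]
      by (auto simp: nbr_def block_start_def)
  qed
  show ?thesis
  proof (cases d)
    case True
    then show ?thesis using *[of s t] assms by auto
  next
    case False
    then show ?thesis using *[of t s] assms nbr_sym[of _ False] by auto
  qed
qed

end


section \<open>Two groupings of the same blocks\<close>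

lemma sources_pair:
  "{first_source \<xi> (x, y), second_source \<xi> (x, y)} = {(x - 1, y), (x, y - 1)}"
  by (auto simp: first_source_def second_source_def)

text \<open>Both lines have the same blocks of level \<open>n\<close>; they may be grouped differently at level \<open>n + 1\<close>.\<close>

locale agreeing_lines = A: adic_line \<xi> G + B: adic_line \<xi> H
  for \<xi> :: ordering and G H :: "int \<Rightarrow> nat \<Rightarrow> edge" +
  fixes n :: nat
  assumes agree: "initial_segment n (G m) = initial_segment n (H m)"
begin

lemma swap: "agreeing_lines \<xi> H G n"
  by unfold_locales (simp add: agree)

lemma V_eq: "B.V n m = A.V n m"
  using same_segment_vertex[OF A.path B.path agree] by simp

lemma R_eq: "B.R n m = A.R n m"
  by (rule same_segment_rank[OF agree, symmetric])

lemma nbr_eq: "B.nbr n d s t = A.nbr n d s t"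
  by (simp add: A.nbr_def B.nbr_def V_eq R_eq)

text \<open>Being mates is symmetric, and the position of a mate is determined by the vertices of the block
and of the pair. Hence if the second line had the vertex \<open>(x, y)\<close> at the mate, then it would have it at \<open>s\<close> as
well.\<close>

lemma mate_disagree:
  assumes s: "A.R n s = 0" and w: "A.V (Suc n) s = (x, y)" "x \<ge> 1" "y \<ge> 1"
    and ne: "B.V (Suc n) s \<noteq> (x, y)"
  obtains t d where "A.nbr n d s t" "A.V (Suc n) t = (x, y)"
    "A.block_start (Suc n) t = A.block_start (Suc n) s"
    "{A.V n s, A.V n t} = {(x - 1, y), (x, y - 1)}" "B.V (Suc n) t \<noteq> (x, y)"
proof -
  have inner: "inner (x, y)" using w by (simp add: inner_def)
  obtain t d where t: "A.nbr n d s t" "A.V (Suc n) t = (x, y)"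
    "A.block_start (Suc n) t = A.block_start (Suc n) s"
    "{A.V n s, A.V n t} = {first_source \<xi> (x, y), second_source \<xi> (x, y)}"
    "A.V n t \<noteq> A.V n s" "d \<longleftrightarrow> A.V n s = first_source \<xi> (x, y)"
    using A.mate[OF s] inner w by metis
  have "B.V (Suc n) t \<noteq> (x, y)"
  proof
    assume wt: "B.V (Suc n) t = (x, y)"
    have "B.R n t = 0" using t(1) by (simp add: A.nbr_def R_eq)
    then obtain u e where u: "B.nbr n e t u" "B.V (Suc n) u = (x, y)"
      "e \<longleftrightarrow> B.V n t = first_source \<xi> (x, y)"
      using B.mate[of t n] inner wt by metis
    have "e \<longleftrightarrow> \<not> d"
      using u(3) t(4-6) by (auto simp: V_eq doubleton_eq_iff)
    then have "u = s"
      using u(1) t(1) A.nbr_sym[of n d s t] A.nbr_unique[of n e t] by (simp add: nbr_eq)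
    then show False using u(2) ne by simp
  qed
  then show ?thesis using that[of d t] t sources_pair by metis
qed

lemma next_vertices:
  assumes "A.V n m = (x, y)"
  shows "A.V (Suc n) m \<in> {(Suc x, y), (x, Suc y)}" "B.V (Suc n) m \<in> {(Suc x, y), (x, Suc y)}"
  using A.is_edge_V[of m n] B.is_edge_V[of m n] assms V_eq[of m] by (auto simp: is_edge_def)

end

text \<open>At a vertex \<open>(x, y)\<close> with \<open>x \<ge> 1\<close>, exactly one of two disagreeing lines goes on to
\<open>(x, y + 1)\<close>, and there the mate has the vertex \<open>(x - 1, y + 1)\<close>. So the abscissa can be lowered
until it vanishes.\<close>

lemma disagreement_at_left_boundary:
  assumes "agreeing_lines \<xi> G H n"
    and "rank \<xi> (G s) n = 0" "fst (G s n) = (x, y)" "fst (G s (Suc n)) \<noteq> fst (H s (Suc n))"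
  shows "\<exists>s. rank \<xi> (G s) n = 0 \<and> fst (G s n) = (0, x + y) \<and> fst (G s (Suc n)) \<noteq> fst (H s (Suc n))"
  using assms(2-)
proof (induction x arbitrary: s y)
  case 0
  then show ?case by auto
next
  case (Suc x)
  interpret agreeing_lines \<xi> G H n by fact
  interpret sw: agreeing_lines \<xi> H G n by (rule swap)
  have "\<exists>t. A.R n t = 0 \<and> A.V n t = (x, Suc y) \<and> A.V (Suc n) t \<noteq> B.V (Suc n) t"
  proof (cases "A.V (Suc n) s = (Suc x, Suc y)")
    case True
    then obtain t d where "A.nbr n d s t" "A.V (Suc n) t = (Suc x, Suc y)"
      "{A.V n s, A.V n t} = {(Suc x - 1, Suc y), (Suc x, Suc y - 1)}" "B.V (Suc n) t \<noteq> (Suc x, Suc y)"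
      using mate_disagree[OF Suc.prems(1), of "Suc x" "Suc y"] Suc.prems(3)
      by (metis Suc_le_mono One_nat_def le0)
    then show ?thesis
      using Suc.prems(2) by (intro exI[of _ t]) (auto simp: A.nbr_def doubleton_eq_iff)
  next
    case False
    then have "B.V (Suc n) s = (Suc x, Suc y)"
      using next_vertices[OF Suc.prems(2)] Suc.prems(3) by auto
    then obtain t d where "B.nbr n d s t" "B.V (Suc n) t = (Suc x, Suc y)"
      "{B.V n s, B.V n t} = {(Suc x - 1, Suc y), (Suc x, Suc y - 1)}" "A.V (Suc n) t \<noteq> (Suc x, Suc y)"
      using sw.mate_disagree[of s "Suc x" "Suc y"] Suc.prems(1) False R_eq
      by (metis Suc_le_mono One_nat_def le0)
    then show ?thesis
      using Suc.prems(2)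
      by (intro exI[of _ t]) (auto simp: B.nbr_def R_eq V_eq doubleton_eq_iff)
  qed
  then show ?case using Suc.IH[of _ "Suc y"] by auto
qed

text \<open>The vertices of the blocks \<open>s0\<close>, \<open>s1\<close>, \<open>s2\<close>, \<open>s3\<close> have abscissas \<open>0\<close>, \<open>1\<close>, \<open>2\<close>, \<open>3\<close>, and each block is the mate
of the one before it, in the two lines alternately. They lie in a row, for turning back would lead to a
block with a smaller abscissa. In the second line, the vertices one level up are then \<open>(0, n + 1)\<close>,
\<open>(2, n - 1)\<close> and \<open>(4, n - 3)\<close>, and the middle one has no possible mate.\<close>

lemma (in agreeing_lines) no_disagreement_at_left_boundary:
  assumes n: "n \<ge> 3" and s0: "A.R n s0 = 0" "A.V n s0 = (0, n)"
    and A0: "A.V (Suc n) s0 = (1, n)" and B0: "B.V (Suc n) s0 = (0, Suc n)"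
  shows False
proof -
  interpret sw: agreeing_lines \<xi> H G n by (rule swap)
  obtain s1 d where s1': "A.nbr n d s0 s1" "A.V (Suc n) s1 = (1, n)" "B.V (Suc n) s1 \<noteq> (1, n)"
    "{A.V n s0, A.V n s1} = {(1 - 1, n), (1, n - 1)}"
    by (rule mate_disagree[OF s0(1) A0]) (use n B0 in auto)
  then have s1: "A.nbr n d s0 s1" "A.V (Suc n) s1 = (1, n)" "A.V n s1 = (1, n - 1)"
    "B.V (Suc n) s1 \<noteq> (1, n)"
    using s0(2) by (auto simp: doubleton_eq_iff)
  have B1: "B.V (Suc n) s1 = (2, n - 1)"
    using next_vertices(2)[OF s1(3)] s1(4) n by auto
  have d1: "B.nbr n (\<not> d) s1 s0"
    using s1(1) A.nbr_sym by (simp add: nbr_eq)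
  have R1: "B.R n s1 = 0" using s1(1) by (simp add: A.nbr_def R_eq)
  obtain s2 d' where s2': "B.nbr n d' s1 s2" "B.V (Suc n) s2 = (2, n - 1)"
    "B.block_start (Suc n) s2 = B.block_start (Suc n) s1" "A.V (Suc n) s2 \<noteq> (2, n - 1)"
    "{B.V n s1, B.V n s2} = {(2 - 1, n - 1), (2, n - 1 - 1)}"
    by (rule sw.mate_disagree[OF R1 B1]) (use n s1(2) in auto)
  then have s2: "B.nbr n d' s1 s2" "B.V (Suc n) s2 = (2, n - 1)"
    "B.block_start (Suc n) s2 = B.block_start (Suc n) s1"
    "A.V n s2 = (2, n - 2)" "A.V (Suc n) s2 \<noteq> (2, n - 1)"
    using s1(3) by (auto simp: doubleton_eq_iff V_eq)
  have A2: "A.V (Suc n) s2 = (3, n - 2)"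
    using next_vertices(1)[OF s2(4)] s2(5) n by (auto simp: numeral_3_eq_3 numeral_2_eq_2 Suc_diff_Suc)
  have "d' = d"
    using B.nbr_unique[of n d' s1 s2 s0] d1 s2(1,4) s0(2) by (cases "d' = (\<not> d)") auto
  then have d2: "A.nbr n d s1 s2" using s2(1) by (simp add: nbr_eq)
  have R2: "A.R n s2 = 0" using d2 by (simp add: A.nbr_def)
  obtain s3 d'' where s3': "A.nbr n d'' s2 s3" "B.V (Suc n) s3 \<noteq> (3, n - 2)"
    "{A.V n s2, A.V n s3} = {(3 - 1, n - 2), (3, n - 2 - 1)}"
    by (rule mate_disagree[OF R2 A2]) (use n s2(2) in auto)
  then have s3: "A.nbr n d'' s2 s3" "A.V n s3 = (3, n - 3)" "B.V (Suc n) s3 \<noteq> (3, n - 2)"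
    using s2(4) by (auto simp: doubleton_eq_iff)
  have B3: "B.V (Suc n) s3 = (4, n - 3)"
    using next_vertices(2)[OF s3(2)] s3(3) n by (auto simp: Suc_diff_le)
  have "d'' = d"
    using A.nbr_unique[of n d'' s2 s3 s1] A.nbr_sym[of n d s1 s2] d2 s3(1,2) s1(3)
    by (cases "d'' = (\<not> d)") auto
  then have d3: "B.nbr n d s2 s3" using s3(1) by (simp add: nbr_eq)
  \<comment> \<open>The block of level \<open>n + 1\<close> made of \<open>s1\<close> and \<open>s2\<close>, and its two neighbours.\<close>
  define S where "S = B.block_start (Suc n) s1"
  have left: "B.nbr (Suc n) (\<not> d) S (B.block_start (Suc n) s0)"
    using B.nbr_Suc[OF d1] B0 B1 by (simp add: S_def)
  have right: "B.nbr (Suc n) d S (B.block_start (Suc n) s3)"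
    using B.nbr_Suc[OF d3] B3 s2(2,3) by (simp add: S_def)
  have S: "B.R (Suc n) S = 0" "B.V (Suc n) S = (2, n - 1)"
    using B.R_block_start[of "Suc n" s1] B.V_block_start[of "Suc n" s1] B1 by (simp_all add: S_def)
  have up: "B.V (Suc (Suc n)) S \<in> {(3, n - 1), (2, n)}"
    using B.is_edge_V[of S "Suc n"] S(2) n by (auto simp: is_edge_def)
  then have "inner (B.V (Suc (Suc n)) S)" using n by (auto simp: inner_def)
  then obtain t e where t: "B.nbr (Suc n) e S t"
    and pair: "{B.V (Suc n) S, B.V (Suc n) t} =
      {first_source \<xi> (B.V (Suc (Suc n)) S), second_source \<xi> (B.V (Suc (Suc n)) S)}"
    using B.mate[OF S(1)] by metis
  from up have Vt: "B.V (Suc n) t = (3, n - 2) \<or> B.V (Suc n) t = (1, n)"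
  proof
    assume "B.V (Suc (Suc n)) S = (3, n - 1)"
    then have "{(2, n - 1), B.V (Suc n) t} = {(2, n - 1), (3, n - 2)}"
      using pair S(2) sources_pair[of \<xi> 3 "n - 1"]
      by (simp add: numeral_2_eq_2)
    then show ?thesis by (simp add: doubleton_eq_iff)
  next
    assume "B.V (Suc (Suc n)) S \<in> {(2, n)}"
    then have "{(2, n - 1), B.V (Suc n) t} = {(1, n), (2, n - 1)}"
      using pair S(2) sources_pair[of \<xi> 2 n] by simp
    then show ?thesis by (simp add: doubleton_eq_iff)
  qed
  have "t = B.block_start (Suc n) s3 \<or> t = B.block_start (Suc n) s0"
    using t left right B.nbr_unique by (cases "e = d") auto
  then show False
    using Vt B0 B3 by (auto simp: B.V_block_start)
qed

text \<open>A disagreement can be moved to the left boundary, where one line goes on to \<open>(0, n + 1)\<close> and the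
other to \<open>(1, n)\<close>; which one does which is a matter of exchanging the lines.\<close>

lemma (in agreeing_lines) agree_Suc:
  assumes n: "n \<ge> 3"
  shows "initial_segment (Suc n) (G m) = initial_segment (Suc n) (H m)"
proof -
  interpret sw: agreeing_lines \<xi> H G n by (rule swap)
  have level: "fst (A.V j m) + snd (A.V j m) = j" for j m
  proof (induction j)
    case 0
    then show ?case using A.path[of m] by (simp add: path_space_def)
  next
    case (Suc j)
    then show ?case using A.is_edge_V[of m j] by (auto simp: is_edge_def)
  qed
  have "A.V (Suc n) m = B.V (Suc n) m"
  proof (rule ccontr)
    assume ne: "A.V (Suc n) m \<noteq> B.V (Suc n) m"
    define s where "s = A.block_start n m"
    have "B.block_start n m = s" by (simp add: s_def A.block_start_def B.block_start_def R_eq)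
    then have "A.V (Suc n) s \<noteq> B.V (Suc n) s"
      using ne A.V_Suc_block_start[of n m] B.V_Suc_block_start[of n m] by (simp add: s_def)
    then obtain s0 where s0: "A.R n s0 = 0" "A.V n s0 = (0, n)" "A.V (Suc n) s0 \<noteq> B.V (Suc n) s0"
      using disagreement_at_left_boundary[OF agreeing_lines_axioms, of s "fst (A.V n s)" "snd (A.V n s)"]
        A.R_block_start[of n m] level[of s n] by (auto simp: s_def)
    then show False
      using next_vertices[OF s0(2)] no_disagreement_at_left_boundary[OF n, of s0]
        sw.no_disagreement_at_left_boundary[OF n, of s0] by (auto simp: R_eq V_eq)
  qed
  then have "G m n = H m n"
    using path_space_edge[OF A.path, of m n] path_space_edge[OF B.path, of m n] V_eq[of m] by simp
  then show ?thesis using agree[of m] by (simp add: initial_segment_def)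
qed

section \<open>Faithfulness of the 3-coding\<close>

theorem theorem3p4:
  fixes \<xi> :: ordering and k :: nat
    and \<omega> \<omega>' :: "int \<Rightarrow> edge list"
    and S S' :: scheme
    and \<gamma> \<gamma>' :: "nat \<Rightarrow> edge"
  assumes "k \<ge> 1"
    and "\<forall>p. \<omega> p \<in> paths_of_length k" and "\<forall>p. \<omega>' p \<in> paths_of_length k"
    and "consistent_scheme \<xi> k \<omega> S" and "consistent_scheme \<xi> k \<omega>' S'"
    and "\<gamma> \<in> path_space" and "\<gamma>' \<in> path_space"
    and "\<gamma> = orbit \<xi> k S 0" and "\<gamma>' = orbit \<xi> k S' 0"
    and "\<gamma> \<noteq> \<gamma>'"
  shows "\<exists>m::int. three_coding \<xi> k S m \<noteq> three_coding \<xi> k S' m"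
proof (rule ccontr)
  let ?G = "orbit \<xi> k S" and ?H = "orbit \<xi> k S'"
  assume "\<not> ?thesis"
  then have 3: "initial_segment 3 (?G m) = initial_segment 3 (?H m)" for m
    by (simp add: three_coding_def)
  interpret A: adic_line \<xi> ?G
    using orbit_in_path_space[OF assms(4)] orbit_follows[OF assms(4)] by unfold_locales
  interpret B: adic_line \<xi> ?H
    using orbit_in_path_space[OF assms(5)] orbit_follows[OF assms(5)] by unfold_locales
  have agree: "\<forall>m. initial_segment n (?G m) = initial_segment n (?H m)" if "3 \<le> n" for n
    using that
  proof (induction n rule: dec_induct)
    case base
    then show ?case using 3 by blast
  next
    case (step n)
    then interpret agreeing_lines \<xi> ?G ?H n
      by unfold_locales simp
    show ?case using agree_Suc[OF step.hyps(1)] by blast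
  qed
  have "\<gamma> j = \<gamma>' j" for j
  proof -
    have "initial_segment (j + 3) \<gamma> ! j = initial_segment (j + 3) \<gamma>' ! j"
      using agree[of "j + 3"] assms(8,9) by simp
    then show ?thesis by (simp add: initial_segment_def nth_append)
  qed
  then show False using assms(10) by blast
qed

end
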